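(* Let $m\ge 3$ and let $\alpha_1,\dots,\alpha_m\in(0,\pi)$ satisfy $\alpha_1+\cdots+\alpha_m<(m-2)\pi$ and $\alpha_1\neq\alpha_2$. Let $x>0$ be the radius of the inscribed circle of the convex polygon in $\mathbb{H}^2$ with interior angles $\alpha_1,\dots,\alpha_m$ (in some given cyclic order) that circumscribes a circle, and for $\alpha\in(0,\pi)$ put $$\beta(\alpha)=2\sin^{-1}\left(\frac{\cos(\alpha/2)}{\cosh x}\right).$$ Let $\beta_1=\beta(\alpha_1)$ and $\beta_2=\beta(\alpha_2)$ be the central angles corresponding to $\alpha_1$ and $\alpha_2$. Then, with this fixed $x$, $$\beta\left(\frac{\alpha_1+\alpha_2}{2}\right)>\frac{\beta_1+\beta_2}{2}.$$ Consequently, if $x'$ denotes the radius of the inscribed circle of the convex polygon in $\mathbb{H}^2$ that circumscribes a circle and has the interior angles obtained from $\alpha_1,\dots,\alpha_m$ by replacing both $\alpha_1$ and $\alpha_2$ by $\frac{\alpha_1+\alpha_2}{2}$ and leaving all the other angles unchanged, then $x'>x$.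
   Context: $\mathbb{H}^2$ is the hyperbolic plane of curvature $-1$. A convex polygon circumscribes a circle if all its sides are tangent to the circle; the circle is then called the inscribed circle. Known fact (Lučić–Molnár): for given angles $\alpha_1,\dots,\alpha_m\in(0,\pi)$, $m\ge3$, with $\sum_i\alpha_i<(m-2)\pi$, there is, up to isometry and respecting the order of the angles, exactly one convex polygon in $\mathbb{H}^2$ with these interior angles that circumscribes a circle. If its inscribed circle has centre $X$ and radius $x$, the central angle $\beta_i$ corresponding to $\alpha_i$ is the angle at $X$ between the radii to the points of tangency of the two sides meeting at the vertex with angle $\alpha_i$. It satisfies $\cos(\alpha_i/2)=\cosh x\,\sin(\beta_i/2)$, and $x>0$ is the value for which $\sum_{i=1}^m 2\sin^{-1}\left(\frac{\cos(\alpha_i/2)}{\cosh x}\right)=2\pi$. *)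

theory Defs
  imports "HOL-Analysis.Analysis"
begin

text \<open>
  The hyperboloid model of the hyperbolic plane of curvature -1: the upper sheet of the
  unit hyperboloid in Minkowski space, with the induced Riemannian metric.
\<close>

definition mink :: "real ^ 3 \<Rightarrow> real ^ 3 \<Rightarrow> real" where
  "mink p q = p $ 1 * q $ 1 + p $ 2 * q $ 2 - p $ 3 * q $ 3"

definition H2 :: "(real ^ 3) set" where
  "H2 = {p. mink p p = - 1 \<and> p $ 3 > 0}"

definition hdist :: "real ^ 3 \<Rightarrow> real ^ 3 \<Rightarrow> real" where
  "hdist p q = arcosh (- mink p q)"

definition hline :: "real ^ 3 \<Rightarrow> real ^ 3 \<Rightarrow> (real ^ 3) set" where
  "hline p q = H2 \<inter> span {p, q}"

definition hsegment :: "real ^ 3 \<Rightarrow> real ^ 3 \<Rightarrow> (real ^ 3) set" where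
  "hsegment p q = {z \<in> H2. \<exists>a \<ge> 0. \<exists>b \<ge> 0. z = a *\<^sub>R p + b *\<^sub>R q}"

definition hcircle :: "real ^ 3 \<Rightarrow> real \<Rightarrow> (real ^ 3) set" where
  "hcircle X r = {z \<in> H2. hdist X z = r}"

text \<open>
  For distinct points \<open>p\<close>, \<open>q\<close> of the plane, \<open>hdir p q\<close> is the component of \<open>q\<close> that is
  Minkowski-orthogonal to \<open>p\<close>: a nonzero tangent vector at \<open>p\<close> pointing along the geodesic
  from \<open>p\<close> to \<open>q\<close>. On tangent vectors the form \<open>mink\<close> is positive definite, and \<open>hangle p q r\<close>
  is the Riemannian angle at \<open>p\<close> between the geodesics to \<open>q\<close> and to \<open>r\<close>.
\<close>

definition hdir :: "real ^ 3 \<Rightarrow> real ^ 3 \<Rightarrow> real ^ 3" where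
  "hdir p q = q + mink p q *\<^sub>R p"

definition hangle :: "real ^ 3 \<Rightarrow> real ^ 3 \<Rightarrow> real ^ 3 \<Rightarrow> real" where
  "hangle p q r =
     arccos (mink (hdir p q) (hdir p r) /
       (sqrt (mink (hdir p q) (hdir p q)) * sqrt (mink (hdir p r) (hdir p r))))"

text \<open>
  A polygon with \<open>m\<close> vertices is given by its vertices \<open>v 0, \<dots>, v (m - 1)\<close> in cyclic order
  (either orientation); side \<open>k\<close> joins \<open>v k\<close> to its successor. It is convex if for each side
  all remaining vertices lie strictly on one side of the line carrying it. That open
  half-plane is the part of \<open>H2\<close> where a linear functional vanishing on the line is positive.
  Strictness makes every \<open>v k\<close> a proper vertex (interior angle less than \<open>\<pi>\<close>), so the sides
  traverse the boundary of the hull of the vertices once and the interior angle is the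
  angle between the two sides.
\<close>

definition next_ix :: "nat \<Rightarrow> nat \<Rightarrow> nat" where
  "next_ix m k = (k + 1) mod m"

definition prev_ix :: "nat \<Rightarrow> nat \<Rightarrow> nat" where
  "prev_ix m k = (k + m - 1) mod m"

definition convex_hpolygon :: "nat \<Rightarrow> (nat \<Rightarrow> real ^ 3) \<Rightarrow> bool" where
  "convex_hpolygon m v \<longleftrightarrow>
     3 \<le> m \<and> (\<forall>k<m. v k \<in> H2) \<and> inj_on v {..<m} \<and>
     (\<forall>k<m. \<exists>n. n \<bullet> v k = 0 \<and> n \<bullet> v (next_ix m k) = 0 \<and>
        (\<forall>l<m. l \<noteq> k \<longrightarrow> l \<noteq> next_ix m k \<longrightarrow> 0 < n \<bullet> v l))"

definition interior_angle :: "nat \<Rightarrow> (nat \<Rightarrow> real ^ 3) \<Rightarrow> nat \<Rightarrow> real" where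
  "interior_angle m v k = hangle (v k) (v (prev_ix m k)) (v (next_ix m k))"

text \<open>
  The circle with centre \<open>X\<close> and radius \<open>x\<close> is tangent to side \<open>k\<close> at \<open>T k\<close>: the line carrying
  the side meets the circle in \<open>T k\<close> only, and \<open>T k\<close> belongs to the side itself (which
  excludes escribed circles).
\<close>

definition inscribed_circle ::
    "nat \<Rightarrow> (nat \<Rightarrow> real ^ 3) \<Rightarrow> real ^ 3 \<Rightarrow> real \<Rightarrow> (nat \<Rightarrow> real ^ 3) \<Rightarrow> bool" where
  "inscribed_circle m v X x T \<longleftrightarrow>
     X \<in> H2 \<and> 0 < x \<and>
     (\<forall>k<m. T k \<in> hsegment (v k) (v (next_ix m k)) \<and>
        hline (v k) (v (next_ix m k)) \<inter> hcircle X x = {T k})"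

text \<open>The sides meeting at \<open>v k\<close> are those with indices \<open>prev_ix m k\<close> and \<open>k\<close>.\<close>

definition central_angle :: "nat \<Rightarrow> real ^ 3 \<Rightarrow> (nat \<Rightarrow> real ^ 3) \<Rightarrow> nat \<Rightarrow> real" where
  "central_angle m X T k = hangle X (T (prev_ix m k)) (T k)"

definition beta :: "real \<Rightarrow> real \<Rightarrow> real" where
  "beta x a = 2 * arcsin (cos (a / 2) / cosh x)"

end

theory Submission
  imports Defs
begin

text \<open>
  Why the theorem is true. Let a convex polygon circumscribe a circle with centre \<open>X\<close> and radius
  \<open>x\<close>. At a vertex with angle \<open>\<alpha>\<close>, the centre, the vertex and the two adjacent tangent points
  form a kite with right angles at the tangent points, and hyperbolic trigonometry gives
  \<open>cos (\<alpha> / 2) = cosh x * sin (\<beta> / 2)\<close> for its angle \<open>\<beta>\<close> at \<open>X\<close>; that is, \<open>\<beta> = beta x \<alpha>\<close>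
  (\<open>tangential_kite\<close>). The kites fill the polygon and surround \<open>X\<close> once, so the central angles
  sum to \<open>2 * pi\<close>, and the inradius satisfies \<open>(\<Sum>k. beta x (\<alpha> k)) = 2 * pi\<close>, an equation in
  which the order of the angles does not occur.

  For \<open>x > 0\<close> the function \<open>beta x\<close> is strictly midpoint concave (\<open>beta_midpoint\<close>), because it
  brings two angles strictly closer together while \<open>sin (\<beta> / 2)\<close> stays proportional to
  \<open>cos (\<alpha> / 2)\<close>. Hence averaging two different angles at fixed \<open>x\<close> pushes the sum
  above \<open>2 * pi\<close>. Since \<open>beta x a\<close> decreases with \<open>x\<close> (\<open>beta_antimono\<close>), the radius has to
  grow to bring the sum back to \<open>2 * pi\<close>.

  Most of the work is to show that the central angles sum to \<open>2 * pi\<close>. A line that meets the circle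
  in the single point \<open>t\<close> is \<open>{y. mink X y = cosh x * mink t y}\<close> (\<open>tangent_line_polar\<close>).
  Convexity places all vertices on one side of each such line, and in fact on the side of \<open>X\<close>.
  In the Klein model centred at \<open>X\<close> this becomes a statement about unit complex numbers \<open>u k\<close> and
  intersection points \<open>w k\<close> of tangents of the unit circle: the functional \<open>z \<mapsto> Re (w k * cnj z)\<close>
  is 1 at \<open>u k\<close> and \<open>u (k + 1)\<close> and less than 1 at all other tangent points. Therefore the short
  arc from \<open>u k\<close> to \<open>u (k + 1)\<close> contains no further tangent point. Two consecutive arcs of opposite
  orientation would overlap and violate this, so the tangent points run around the circle
  monotonically; a second turn would sweep an arc across the starting point
  (\<open>sum_central_arcs\<close>).
\<close>

section \<open>The Minkowski form\<close>

lemma mink_commute: "mink p q = mink q p"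
  by (simp add: mink_def mult.commute)

lemma mink_add_left: "mink (p + q) r = mink p r + mink q r"
  and mink_add_right: "mink r (p + q) = mink r p + mink r q"
  and mink_diff_left: "mink (p - q) r = mink p r - mink q r"
  and mink_diff_right: "mink r (p - q) = mink r p - mink r q"
  and mink_scaleR_left: "mink (c *\<^sub>R p) r = c * mink p r"
  and mink_scaleR_right: "mink r (c *\<^sub>R p) = c * mink r p"
  by (simp_all add: mink_def algebra_simps)
lemmas mink_bilinear = mink_add_left mink_add_right mink_diff_left mink_diff_right
  mink_scaleR_left mink_scaleR_right

lemma vec3_eq_iff: "p = q \<longleftrightarrow> p $ 1 = q $ 1 \<and> p $ 2 = q $ 2 \<and> p $ 3 = (q $ 3 :: real)" for p q :: "real^3"
  by (simp add: vec_eq_iff forall_3)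

text \<open>
  The Minkowski form is the Euclidean inner product after this reflection, which makes the Euclidean
  cross product available for lines of the hyperbolic plane.
\<close>

definition flip :: "real^3 \<Rightarrow> real^3" where
  "flip n = vector [n$1, n$2, - n$3]"

lemma mink_eq_inner_flip: "mink n y = flip n \<bullet> y"
  by (simp add: flip_def mink_def inner_vec_def sum_3)

lemma flip_eq_0_iff: "flip n = 0 \<longleftrightarrow> n = 0"
  by (simp add: flip_def vec3_eq_iff)

text \<open>
  Both equations come from \<open>n \<times> (p \<times> q) = 0\<close>, by expanding a further cross product on the left.
\<close>

lemma orthogonal_imp_parallel_cross3:
  fixes n p q :: "real^3"
  assumes "n \<bullet> p = 0" "n \<bullet> q = 0"
  shows "(n \<bullet> n) *\<^sub>R cross3 p q = (n \<bullet> cross3 p q) *\<^sub>R n"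
    and "(cross3 p q \<bullet> cross3 p q) *\<^sub>R n = (n \<bullet> cross3 p q) *\<^sub>R cross3 p q"
proof -
  have z: "cross3 n (cross3 p q) = 0" by (simp add: Lagrange assms)
  from arg_cong[OF z, of "cross3 n"]
  show "(n \<bullet> n) *\<^sub>R cross3 p q = (n \<bullet> cross3 p q) *\<^sub>R n"
    by (simp add: Lagrange[of n n "cross3 p q"] del: Lagrange)
  from arg_cong[OF z, of "cross3 (cross3 p q)"]
  show "(cross3 p q \<bullet> cross3 p q) *\<^sub>R n = (n \<bullet> cross3 p q) *\<^sub>R cross3 p q"
    by (simp add: Lagrange[of "cross3 p q" n "cross3 p q"] inner_commute)
qed

text \<open>
  A Gram determinant is the determinant of the form times the squared volume; the form has
  determinant \<open>- 1\<close>.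
\<close>

lemma mink_gram:
  "mink a a * (mink b b * mink c c - (mink b c)\<^sup>2) - mink a b * (mink a b * mink c c - mink b c * mink a c)
    + mink a c * (mink a b * mink b c - mink b b * mink a c) = - (cross3 a b \<bullet> c)\<^sup>2"
  by (simp add: mink_def cross3_def inner_vec_def sum_3 algebra_simps power2_eq_square)

lemma coplanar_if_common_normal:
  assumes "n \<noteq> 0" "mink n a = 0" "mink n b = 0" "mink n c = 0"
  shows "cross3 a b \<bullet> c = 0"
proof -
  have "(flip n \<bullet> flip n) * (cross3 a b \<bullet> c) = (flip n \<bullet> cross3 a b) * (flip n \<bullet> c)"
    using arg_cong[OF orthogonal_imp_parallel_cross3(1)[of "flip n" a b], of "\<lambda>z. z \<bullet> c"] assms
    by (simp add: mink_eq_inner_flip)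
  then show ?thesis using assms by (simp add: mink_eq_inner_flip flip_eq_0_iff)
qed

lemma mink_self: "p \<in> H2 \<Longrightarrow> mink p p = - 1"
  by (simp add: H2_def)

text \<open>
  The reversed Cauchy-Schwarz inequality. It makes \<open>hdist\<close> well defined and separates points.
\<close>

lemma H2_mink_le:
  assumes "p \<in> H2" "q \<in> H2"
  shows "mink p q \<le> - 1" and "mink p q = - 1 \<longleftrightarrow> p = q"
proof -
  define a where "a = 1 + p$1 * q$1 + p$2 * q$2"
  have p: "(p$3)\<^sup>2 = 1 + (p$1)\<^sup>2 + (p$2)\<^sup>2" "p$3 > 0" and q: "(q$3)\<^sup>2 = 1 + (q$1)\<^sup>2 + (q$2)\<^sup>2" "q$3 > 0"
    using assms by (auto simp: H2_def mink_def power2_eq_square)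
  have eq: "(p$3 * q$3)\<^sup>2 - a\<^sup>2 = (p$1 - q$1)\<^sup>2 + (p$2 - q$2)\<^sup>2 + (p$1 * q$2 - p$2 * q$1)\<^sup>2"
    unfolding power_mult_distrib p q a_def by algebra
  have "a\<^sup>2 \<le> (p$3 * q$3)\<^sup>2" using eq by (smt (verit) zero_le_power2)
  then have "a \<le> p$3 * q$3" using p q by (auto intro: power2_le_imp_le)
  then show "mink p q \<le> - 1" by (simp add: a_def mink_def)
  show "mink p q = - 1 \<longleftrightarrow> p = q"
  proof
    assume "mink p q = - 1"
    then have "p$3 * q$3 = a" by (simp add: a_def mink_def)
    with eq have "(p$1 - q$1)\<^sup>2 + (p$2 - q$2)\<^sup>2 + (p$1 * q$2 - p$2 * q$1)\<^sup>2 = 0" by simp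
    then have 1: "p$1 = q$1" "p$2 = q$2"
      by (smt (verit) zero_le_power2 power2_eq_iff_nonneg power_eq_0_iff)+
    then have "p$3 = q$3" using p q by (metis power2_eq_iff_nonneg less_imp_le)
    with 1 show "p = q" by (simp add: vec3_eq_iff)
  qed (use assms in \<open>auto simp: H2_def\<close>)
qed

text \<open>
  The negative of a vector on the lower sheet lies in \<open>H2\<close>, so a vector on the lower sheet has
  positive product with every point of \<open>H2\<close>.
\<close>

lemma H2_of_mink_neg:
  assumes "X \<in> H2" "mink p p = - 1" "mink X p < 0"
  shows "p \<in> H2"
proof (rule ccontr)
  assume "p \<notin> H2"
  then have "p$3 \<le> 0" using assms by (auto simp: H2_def)
  moreover have "p$3 \<noteq> 0"
  proof
    assume "p$3 = 0"
    then have "p$1 * p$1 + p$2 * p$2 = - 1" using assms(2) by (simp add: mink_def)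
    then show False by (smt (verit) zero_le_square)
  qed
  ultimately have "- p \<in> H2" using assms(2) by (simp add: H2_def mink_def)
  from H2_mink_le(1)[OF assms(1) this] assms(3) show False by (simp add: mink_def)
qed

lemma cross3_H2_nonzero:
  assumes "p \<in> H2" "q \<in> H2" "p \<noteq> q"
  shows "cross3 p q \<noteq> 0"
proof
  assume "cross3 p q = 0"
  then have par: "q$3 * p$1 = p$3 * q$1" "q$3 * p$2 = p$3 * q$2"
    by (simp_all add: cross3_def vec3_eq_iff algebra_simps)
  have "(q$3)\<^sup>2 * mink p p = (p$3)\<^sup>2 * mink q q"
    using par unfolding mink_def by algebra
  then have "p$3 = q$3" using assms(1,2) by (auto simp: H2_def intro: power2_eq_imp_eq)
  with par assms show False by (auto simp: H2_def vec3_eq_iff)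
qed

text \<open>
  Two functionals that vanish on the same line are both multiples of \<open>y \<mapsto> cross3 p q \<bullet> y\<close>. This
  identifies the functional supplied by convexity with the polar functional of the tangent point.
\<close>

lemma line_normal_unique:
  fixes n N p q :: "real^3"
  assumes pq: "p \<in> H2" "q \<in> H2" "p \<noteq> q"
    and n: "n \<bullet> p = 0" "n \<bullet> q = 0" and N: "mink N p = 0" "mink N q = 0" "N \<noteq> 0"
  shows "\<exists>c. \<forall>y. n \<bullet> y = c * mink N y"
proof -
  define M where "M = cross3 p q"
  have M: "M \<bullet> M \<noteq> 0" using cross3_H2_nonzero[OF pq] by (simp add: M_def)
  have 1: "(M \<bullet> M) *\<^sub>R n = (n \<bullet> M) *\<^sub>R M" and 2: "(M \<bullet> M) *\<^sub>R flip N = (flip N \<bullet> M) *\<^sub>R M"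
    using n N orthogonal_imp_parallel_cross3(2)[of _ p q] by (simp_all add: M_def mink_eq_inner_flip)
  have k: "flip N \<bullet> M \<noteq> 0" using 2 M N(3) by (auto simp: flip_eq_0_iff)
  have "(M \<bullet> M) * (n \<bullet> y) = (M \<bullet> M) * ((n \<bullet> M) / (flip N \<bullet> M) * mink N y)" for y
    using arg_cong[OF 1, of "\<lambda>z. z \<bullet> y"] arg_cong[OF 2, of "\<lambda>z. z \<bullet> y"] k
    by (simp add: mink_eq_inner_flip field_simps)
  then show ?thesis using M by (metis mult_cancel_left)
qed

text \<open>
  The frame is the image of the first two coordinate vectors under the Lorentz boost that maps
  \<open>(0, 0, 1)\<close> to \<open>X\<close>. The form expands in it with signature \<open>(+, +, -)\<close>.
\<close>

lemma orthonormal_frame: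
  assumes "X \<in> H2"
  shows "\<exists>e f. \<forall>p q. mink p q = mink e p * mink e q + mink f p * mink f q - mink X p * mink X q"
proof -
  define a b c h where "a = X$1" and "b = X$2" and "c = X$3" and "h = 1 / (1 + X$3)"
  have c: "c\<^sup>2 = 1 + a\<^sup>2 + b\<^sup>2" "c > 0"
    using assms by (auto simp: H2_def mink_def a_def b_def c_def power2_eq_square)
  have h: "h * (1 + c) = 1" using c(2) by (simp add: h_def c_def)
  define e f :: "real^3" where "e = vector [1 + a\<^sup>2 * h, a * b * h, a]" and "f = vector [a * b * h, 1 + b\<^sup>2 * h, b]"
  have s: "h * (a\<^sup>2 + b\<^sup>2) = c - 1" using c h by algebra
  have 1: "(1 + a\<^sup>2 * h)\<^sup>2 + (a * b * h)\<^sup>2 - a\<^sup>2 = 1" using s h by algebra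
  have 2: "(a * b * h)\<^sup>2 + (1 + b\<^sup>2 * h)\<^sup>2 - b\<^sup>2 = 1" using s h by algebra
  have 3: "(1 + a\<^sup>2 * h) * (a * b * h) + (a * b * h) * (1 + b\<^sup>2 * h) - a * b = 0" using s h by algebra
  have 4: "(1 + a\<^sup>2 * h) * a + a * b * h * b = a * c" using s by algebra
  have 5: "a * b * h * a + (1 + b\<^sup>2 * h) * b = b * c" using s by algebra
  have "mink p q = mink e p * mink e q + mink f p * mink f q - mink X p * mink X q" for p q
  proof -
    \<comment> \<open>Collected by coordinates; the six brackets are the entries of the matrix of the form.\<close>
    have "mink e p * mink e q + mink f p * mink f q - mink X p * mink X q =
       ((1 + a\<^sup>2 * h)\<^sup>2 + (a * b * h)\<^sup>2 - a\<^sup>2) * (p$1 * q$1)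
     + ((a * b * h)\<^sup>2 + (1 + b\<^sup>2 * h)\<^sup>2 - b\<^sup>2) * (p$2 * q$2)
     + ((1 + a\<^sup>2 * h) * (a * b * h) + (a * b * h) * (1 + b\<^sup>2 * h) - a * b) * (p$1 * q$2 + p$2 * q$1)
     - ((1 + a\<^sup>2 * h) * a + a * b * h * b - a * c) * (p$1 * q$3 + p$3 * q$1)
     - (a * b * h * a + (1 + b\<^sup>2 * h) * b - b * c) * (p$2 * q$3 + p$3 * q$2)
     + (a\<^sup>2 + b\<^sup>2 - c\<^sup>2) * (p$3 * q$3)"
      by (simp add: mink_def e_def f_def a_def[symmetric] b_def[symmetric] c_def[symmetric] algebra_simps power2_eq_square)
    then show ?thesis unfolding 1 2 3 4 5 c(1) by (simp add: mink_def)
  qed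
  then show ?thesis by blast
qed

section \<open>Tangent lines of a circle\<close>

text \<open>
  Geodesic reflection in the foot of the perpendicular from \<open>X\<close> preserves the line \<open>S\<close> and the
  distance to \<open>X\<close>. So it maps \<open>T\<close> to a point of the line on the same circle, which must be \<open>T\<close>
  itself. Then \<open>T\<close> is the foot of the perpendicular, and the direction \<open>d\<close> of the line at \<open>T\<close> is
  orthogonal to \<open>X\<close>; this is the claimed equation for \<open>y\<close>.
\<close>

lemma tangent_line_polar:
  assumes "X \<in> H2" "subspace S" "H2 \<inter> S \<inter> hcircle X x = {T}" "y \<in> H2" "y \<in> S"
  shows "mink X y = - mink X T * mink T y"
proof (cases "y = T")
  case True
  then show ?thesis using assms by (auto simp: mink_self)
next
  case False
  have T: "T \<in> H2" "T \<in> S" "arcosh (- mink X T) = x" using assms(3) by (auto simp: hcircle_def hdist_def)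
  define C where "C = - mink X T"
  define a where "a = - mink X y"
  define b where "b = - mink T y"
  define d where "d = hdir T y"
  define g where "g = b\<^sup>2 - 1"
  define D where "D = C * b - a"
  have C: "C \<ge> 1" using H2_mink_le[OF assms(1) T(1)] by (simp add: C_def)
  have "b > 1" using H2_mink_le[OF T(1) assms(4)] False by (auto simp: b_def less_le)
  then have g: "g > 0" by (simp add: g_def)
  have dd: "mink d d = g" "mink T d = 0" "mink X d = D"
    using mink_self[OF T(1)] mink_self[OF assms(4)]
    by (simp_all add: d_def g_def D_def C_def a_def b_def hdir_def mink_bilinear mink_commute[of y T] power2_eq_square)
  \<comment> \<open>The Gram determinant of \<open>X\<close>, \<open>T\<close>, \<open>y\<close> shows that the projection of \<open>X\<close> to the plane of the line is timelike.\<close>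
  have "2 * a * b * C - a\<^sup>2 - b\<^sup>2 - C\<^sup>2 + 1 \<ge> 0"
    using mink_gram[of X T y] mink_self[OF T(1)] mink_self[OF assms(4)] mink_self[OF assms(1)]
    by (simp add: a_def b_def C_def algebra_simps power2_eq_square) (smt (verit) zero_le_square)
  moreover have "C\<^sup>2 * g - D\<^sup>2 = (2 * a * b * C - a\<^sup>2 - b\<^sup>2 - C\<^sup>2 + 1) + g"
    by (simp add: g_def D_def) algebra
  ultimately have Q: "C\<^sup>2 * g - D\<^sup>2 > 0" using g by linarith
  define Q where "Q = C\<^sup>2 * g - D\<^sup>2"
  \<comment> \<open>With the projection \<open>P = C *\<^sub>R T + (D / g) *\<^sub>R d\<close> of \<open>X\<close>, for which \<open>mink P P = - Q / g\<close>, the reflected point is\<close>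
  \<comment> \<open>\<open>R = - T + (2 * mink T P / mink P P) *\<^sub>R P\<close>.\<close>
  define l where "l = 2 * C\<^sup>2 * g / Q - 1"
  define r where "r = 2 * C * D / Q"
  define R where "R = l *\<^sub>R T + r *\<^sub>R d"
  have Q0: "Q \<noteq> 0" using Q by (simp add: Q_def)
  then have lr: "l * Q = 2 * C\<^sup>2 * g - Q" "r * Q = 2 * C * D"
    by (simp_all add: l_def r_def field_simps)
  have RR: "mink R R = - 1"
  proof -
    have "mink R R = g * r\<^sup>2 - l\<^sup>2"
      using dd mink_self[OF T(1)] by (simp add: R_def mink_bilinear mink_commute[of d T] power2_eq_square)
    moreover have "Q\<^sup>2 * (g * r\<^sup>2 - l\<^sup>2) = Q\<^sup>2 * - 1"
      using lr Q_def by algebra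
    ultimately show ?thesis using Q0 by (metis mult_cancel_left zero_eq_power2)
  qed
  have XR: "mink X R = - C"
  proof -
    have "mink X R = r * D - l * C"
      using dd by (simp add: R_def mink_bilinear C_def)
    moreover have "Q * (r * D - l * C) = Q * - C"
      using lr Q_def by algebra
    ultimately show ?thesis using Q0 by (metis mult_cancel_left)
  qed
  have "R \<in> H2" using H2_of_mink_neg[OF assms(1) RR] XR C by simp
  moreover have "R \<in> S" unfolding R_def d_def hdir_def
    using assms(2,5) T(2) by (intro subspace_add subspace_scale)
  moreover have "R \<in> hcircle X x" using \<open>R \<in> H2\<close> XR T(3) by (simp add: hcircle_def hdist_def C_def)
  ultimately have "R = T" using assms(3) by blast
  then have "mink R d = 0" using dd by simp
  then have "r * g = 0" using dd by (simp add: R_def mink_bilinear)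
  then have "D = 0" using C g Q0 lr(2) by auto
  then show ?thesis by (simp add: D_def C_def a_def b_def)
qed

section \<open>Angles and tangential kites\<close>

lemma mink_hdir_hdir:
  assumes "p \<in> H2"
  shows "mink (hdir p q) (hdir p r) = mink q r + mink p q * mink p r"
  using mink_self[OF assms] by (simp add: hdir_def mink_bilinear mink_commute[of q p])

text \<open>
  Moving a point along its ray from \<open>p\<close> only rescales its direction, so angles at a vertex may be
  measured with tangent points instead of neighbouring vertices.
\<close>

lemma hangle_scale:
  assumes "a > 0" "b > 0" "p \<in> H2"
  shows "hangle p (a *\<^sub>R q + c *\<^sub>R p) (b *\<^sub>R r + d *\<^sub>R p) = hangle p q r"
proof -
  have h: "hdir p (a *\<^sub>R q + c *\<^sub>R p) = a *\<^sub>R hdir p q" for a c q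
    using mink_self[OF assms(3)] by (simp add: hdir_def mink_bilinear algebra_simps)
  have s: "sqrt (mink (t *\<^sub>R y) (t *\<^sub>R y)) = t * sqrt (mink y y)" if "t > 0" for t y
    using that by (simp add: mink_bilinear real_sqrt_mult mult.assoc[symmetric])
  show ?thesis unfolding hangle_def h using s assms by (simp add: mink_bilinear)
qed

text \<open>
  The hyperbolic law of cosines for equal sides adjacent to the angle. It applies at both \<open>X\<close> and
  \<open>p\<close> in the kite below, because both are equidistant from \<open>T\<close> and \<open>T'\<close>.
\<close>

lemma hangle_isosceles:
  assumes "P \<in> H2" "T \<in> H2" "T' \<in> H2" "mink P T = - c" "mink P T' = - c" "c > 1"
  shows "hangle P T T' = arccos ((mink T T' + c\<^sup>2) / (c\<^sup>2 - 1))"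
proof -
  have "c\<^sup>2 - 1 > 0" using assms(6) by simp
  then show ?thesis using assms
    by (simp add: hangle_def mink_hdir_hdir mink_self power2_eq_square)
qed

text \<open>
  The hypotheses \<open>t\<close> express that \<open>p\<close> lies on the tangents at \<open>T\<close> and \<open>T'\<close>. The centre \<open>X\<close>, the
  vertex \<open>p\<close> and the direction \<open>T + T'\<close> of the midpoint of the chord all lie on the axis of
  symmetry of the kite. The vanishing of their Gram determinant relates \<open>mink T T'\<close>, \<open>cosh x\<close> and
  \<open>mink T p\<close>; in terms of the angles \<open>2 * A\<close> at \<open>p\<close> and \<open>2 * B\<close> at \<open>X\<close> the relation reads
  \<open>cos A = cosh x * sin B\<close>.
\<close>

lemma tangential_kite:
  assumes H: "X \<in> H2" "p \<in> H2" "T \<in> H2" "T' \<in> H2" and ne: "T \<noteq> T'" "p \<noteq> T"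
    and x: "x > 0" and r: "mink X T = - cosh x" "mink X T' = - cosh x"
    and t: "mink X p = cosh x * mink T p" "mink X p = cosh x * mink T' p"
  shows "hangle X T T' = beta x (hangle p T T')"
proof -
  define C where "C = cosh x"
  define E where "E = - mink T p"
  define s where "s = mink T T'"
  have C: "C > 1" using x cosh_real_strict_mono[of 0 x] by (simp add: C_def)
  have E: "E > 1" using H2_mink_le[OF H(3,2)] ne by (auto simp: E_def less_le)
  have s: "s \<le> - 1" using H2_mink_le(1)[OF H(3,4)] by (simp add: s_def)
  have pT: "mink p T = - E" "mink p T' = - E" "mink X p = - C * E"
    using t C by (auto simp: E_def C_def mink_commute[of p])
  define ca where "ca = (s + E\<^sup>2) / (E\<^sup>2 - 1)"
  define cb where "cb = (s + C\<^sup>2) / (C\<^sup>2 - 1)"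
  have \<alpha>: "hangle p T T' = arccos ca" unfolding ca_def s_def
    using hangle_isosceles[OF H(2,3,4) pT(1,2) E] .
  have \<beta>: "hangle X T T' = arccos cb" unfolding cb_def s_def
    using hangle_isosceles[OF H(1,3,4)] r C by (simp add: C_def)
  have C2: "C\<^sup>2 - 1 > 0" and E2: "E\<^sup>2 - 1 > 0" using C E by simp_all
  \<comment> \<open>The common normal \<open>T - T'\<close> is that of the axis of symmetry.\<close>
  have "cross3 X p \<bullet> (T + T') = 0"
    using ne r t x pT
    by (intro coplanar_if_common_normal[of "T - T'"])
       (simp_all add: mink_bilinear mink_self H mink_commute[of T X] mink_commute[of T' X] mink_commute[of T p] mink_commute[of T' p] mink_commute[of T' T])
  moreover have "mink X (T + T') = - (2 * C)" "mink p (T + T') = - (2 * E)" "mink (T + T') (T + T') = 2 * s - 2"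
    using r pT by (simp_all add: mink_bilinear mink_self H C_def s_def mink_commute[of T' T])
  ultimately have "- 1 * (- 1 * (2 * s - 2) - (- (2 * E))\<^sup>2)
      - (- C * E) * ((- C * E) * (2 * s - 2) - (- (2 * E)) * (- (2 * C)))
      + (- (2 * C)) * ((- C * E) * (- (2 * E)) - (- 1) * (- (2 * C))) = 0"
    using mink_gram[of X p "T + T'"] unfolding mink_self[OF H(1)] mink_self[OF H(2)] pT(3) by simp
  then have "(2 * E\<^sup>2 - 1 + s) * (C\<^sup>2 - 1) = C\<^sup>2 * (- s - 1) * (E\<^sup>2 - 1)"
    by algebra
  then have rel: "1 + ca = C\<^sup>2 * (1 - cb)"
    using C2 E2 by (simp add: ca_def cb_def field_simps)
  have ca1: "ca \<le> 1" using s E2 by (simp add: ca_def)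
  have cb1: "cb \<le> 1" using s C2 by (simp add: cb_def)
  \<comment> \<open>Both quotients lie in the domain of \<open>arccos\<close>, so that \<open>cos\<close> inverts it.\<close>
  have "0 \<le> 1 + ca" unfolding rel using cb1 by simp
  have "1 * (1 - cb) \<le> C\<^sup>2 * (1 - cb)" using cb1 C2 by (intro mult_right_mono) auto
  then have "- 1 \<le> cb" using rel ca1 by simp
  define A where "A = arccos ca / 2"
  define B where "B = arccos cb / 2"
  have A: "0 \<le> A" "A \<le> pi/2" "cos (2 * A) = ca"
    using \<open>0 \<le> 1 + ca\<close> ca1 arccos_bounded[of ca] by (auto simp: A_def)
  have B: "0 \<le> B" "B \<le> pi/2" "cos (2 * B) = cb"
    using \<open>- 1 \<le> cb\<close> cb1 arccos_bounded[of cb] by (auto simp: B_def)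
  have "(cos A)\<^sup>2 = (C * sin B)\<^sup>2"
    using rel unfolding A(3)[symmetric] B(3)[symmetric] power_mult_distrib
    by (simp add: cos_double_cos[of A] cos_double_sin[of B])
  moreover have "0 \<le> cos A" "0 \<le> C * sin B"
    using A B C by (auto intro!: cos_ge_zero mult_nonneg_nonneg sin_ge_zero)
  ultimately have "cos A = C * sin B" by (simp add: power2_eq_iff_nonneg)
  then have "arcsin (cos A / C) = B" using C B by (simp add: arcsin_sin)
  then show ?thesis unfolding \<alpha> \<beta> by (simp add: beta_def A_def B_def C_def)
qed

section \<open>Tangential polygons in the Euclidean plane\<close>

lemma mod_shift_inj:
  fixes a b k m :: nat
  assumes "(k + a) mod m = (k + b) mod m" "a < m" "b < m"
  shows "a = b"
proof -
  have le: "y \<le> z" if "(k + y) mod m = (k + z) mod m" "y < m" for y z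
  proof (rule ccontr)
    assume "\<not> y \<le> z"
    then have "m dvd (k + y) - (k + z)" using that(1) by (metis add_le_cancel_left mod_eq_dvd_iff_nat nat_le_linear)
    then have "m \<le> y - z" using \<open>\<not> y \<le> z\<close> by (auto dest: dvd_imp_le)
    then show False using that(2) \<open>\<not> y \<le> z\<close> by linarith
  qed
  show ?thesis using le[of a b] le[of b a] assms by simp
qed

text \<open>
  The tangents of the unit circle at \<open>u\<close> and at \<open>u * cis (s * d)\<close> meet in \<open>w\<close>, and the short arc
  between the two points of tangency bulges towards \<open>w\<close>, beyond the chord: along it the functional
  is \<open>cos (f - d / 2) / cos (d / 2)\<close>. The sign \<open>s\<close> is the orientation of the arc.
\<close>

lemma arc_support:
  fixes u w :: complex
  assumes "Re (w * cnj u) = 1" "Re (w * cnj (u * cis (s * d))) = 1" "s = 1 \<or> s = - 1"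
    "0 < d" "d < pi" "0 \<le> f" "f \<le> d"
  shows "Re (w * cnj (u * cis (s * f))) \<ge> 1"
proof -
  define b where "b = Im (w * cnj u)"
  have e: "Re (w * cnj (u * cis (s * t))) = cos t + b * s * sin t" for t
  proof -
    have "w * cnj (u * cis (s * t)) = (w * cnj u) * cis (- (s * t))"
      by (simp add: cis_cnj)
    moreover have "Re (z * cis (- (s * t))) = Re z * cos t + Im z * s * sin t" for z
      using assms(3) by auto
    ultimately show ?thesis using assms(1) unfolding b_def by (metis mult_1)
  qed
  have 1: "cos d + b * s * sin d = 1" using e assms(2) by metis
  have sd: "sin d = 2 * sin (d/2) * cos (d/2)" using sin_double[of "d/2"] by simp
  have cd: "cos d = 1 - 2 * (sin (d/2))\<^sup>2" using cos_double_sin[of "d/2"] by simp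
  have s0: "sin (d/2) > 0" using assms by (intro sin_gt_zero) auto
  have c0: "cos (d/2) > 0" using assms by (intro cos_gt_zero) auto
  have "2 * sin (d/2) * (b * s * cos (d/2)) = 2 * sin (d/2) * sin (d/2)"
    using 1 unfolding sd cd by (simp add: algebra_simps power2_eq_square)
  then have bs: "b * s * cos (d/2) = sin (d/2)" using s0 by simp
  have "(cos f + b * s * sin f) * cos (d/2) = cos (f - d/2)"
    unfolding cos_diff bs[symmetric] by (simp add: algebra_simps)
  moreover have "cos (f - d/2) \<ge> cos (d/2)"
  proof -
    have "cos (d/2) \<le> cos \<bar>f - d/2\<bar>" using assms by (intro cos_monotone_0_pi_le) (simp_all only: abs_le_iff abs_ge_zero, linarith+)
    then show ?thesis by simp
  qed
  ultimately have "1 * cos (d/2) \<le> (cos f + b * s * sin f) * cos (d/2)" by simp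
  then have "1 \<le> cos f + b * s * sin f" using c0 by (metis mult_le_cancel_right_pos)
  then show ?thesis by (simp only: e)
qed

text \<open>
  By \<open>arc_support\<close>, the hypothesis \<open>less\<close> says that the short arc from \<open>u k\<close> to \<open>u (Suc k)\<close>
  contains no other point of the sequence. The arc has length \<open>d k\<close> and orientation \<open>s k\<close>. If two
  consecutive orientations differ, the shorter arc lies in the longer one, together with its free
  endpoint; so \<open>s\<close> is constant. The partial sums \<open>S n\<close> then give the position of \<open>u n\<close> on the
  circle, measured from \<open>u 0\<close>, and the first arc that reaches \<open>2 * pi\<close> contains \<open>u 0\<close>. Hence
  \<open>u 0\<close> is an endpoint of this arc, which must be the last one.
\<close>

lemma sum_central_arcs:
  fixes u w :: "nat \<Rightarrow> complex" and m :: nat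
  assumes m: "m \<ge> 3"
    and u1: "\<And>k. norm (u k) = 1"
    and per: "u m = u 0"
    and w0: "\<And>k. Re (w k * cnj (u k)) = 1"
    and w1: "\<And>k. Re (w k * cnj (u (Suc k))) = 1"
    and less: "\<And>k j. j mod m \<noteq> k mod m \<Longrightarrow> j mod m \<noteq> Suc k mod m \<Longrightarrow> Re (w k * cnj (u j)) < 1"
  shows "(\<Sum>k<m. arccos (Re (u k * cnj (u (Suc k))))) = 2 * pi"
proof -
  define d where "d k = arccos (Re (u k * cnj (u (Suc k))))" for k
  \<comment> \<open>Three consecutive indices are distinct modulo \<open>m\<close>; here \<open>m \<ge> 3\<close> enters.\<close>
  have ne: "k mod m \<noteq> Suc k mod m" "k mod m \<noteq> Suc (Suc k) mod m" "Suc k mod m \<noteq> Suc (Suc k) mod m" for k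
    using mod_shift_inj[of k 0 m 1] mod_shift_inj[of k 0 m 2] mod_shift_inj[of k 1 m 2] m by auto
  have "\<exists>s. (s = 1 \<or> s = - 1) \<and> 0 < d k \<and> d k < pi \<and> u (Suc k) = u k * cis (s * d k)" for k
  proof -
    define z where "z = u (Suc k) * cnj (u k)"
    have z1: "norm z = 1" by (simp add: z_def norm_mult u1)
    have uk: "u k * cnj (u k) = 1" using u1[of k] by (simp add: complex_norm_square[symmetric])
    then have uS: "u (Suc k) = u k * z" by (simp add: z_def)
    have "Re (u k * cnj (u (Suc k))) = Re z" by (simp add: z_def algebra_simps)
    then have dz: "d k = arccos (Re z)" by (simp add: d_def)
    have z: "z = cis (Arg z)" using z1 by (metis cis_Arg norm_zero sgn_div_norm div_by_1 inverse_1 scaleR_one zero_neq_one)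
    have "d k = \<bar>Arg z\<bar>"
    proof -
      have "Re z = cos \<bar>Arg z\<bar>" using arg_cong[OF z, of Re] by simp
      moreover have "0 \<le> \<bar>Arg z\<bar>" "\<bar>Arg z\<bar> \<le> pi" using Arg_bounded[of z] by auto
      ultimately show ?thesis using dz arccos_cos[of "\<bar>Arg z\<bar>"] by simp
    qed
    \<comment> \<open>Consecutive points differ, since \<open>w (Suc k)\<close> tells them apart, and they are not antipodal, since antipodal tangents are parallel.\<close>
    moreover have "Arg z \<noteq> 0"
    proof
      assume "Arg z = 0"
      then have "u (Suc k) = u k" using z uS by simp
      moreover have "Re (w (Suc k) * cnj (u k)) < 1" using ne by (intro less) auto
      ultimately show False using w0[of "Suc k"] by simp
    qed
    moreover have "Arg z \<noteq> pi"
    proof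
      assume "Arg z = pi"
      then have "u (Suc k) = - u k" using z uS by simp
      then show False using w0[of k] w1[of k] by simp
    qed
    ultimately have "0 < d k" "d k < pi" using Arg_bounded[of z] by auto
    moreover have "u (Suc k) = u k * cis (sgn (Arg z) * d k)"
      using z uS \<open>d k = \<bar>Arg z\<bar>\<close> by (metis mult.commute abs_mult_sgn)
    ultimately show ?thesis using \<open>Arg z \<noteq> 0\<close> by (intro exI[of _ "sgn (Arg z)"]) (auto simp: sgn_if)
  qed
  then obtain s where s: "\<And>k. s k = 1 \<or> s k = - 1" and d: "\<And>k. 0 < d k" "\<And>k. d k < pi"
    and u: "\<And>k. u (Suc k) = u k * cis (s k * d k)" by metis
  have arc: "j mod m = k mod m \<or> j mod m = Suc k mod m"
    if "u j = u k * cis (s k * f)" "0 \<le> f" "f \<le> d k" for j k f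
    using arc_support[OF w0[of k] w1[of k, unfolded u] s d(1,2) that(2,3)] less[of j k] that(1) by force
  have const: "s (Suc k) = s k" for k
  proof (rule ccontr)
    assume "s (Suc k) \<noteq> s k"
    then have opp: "s (Suc k) = - s k" using s[of k] s[of "Suc k"] by auto
    show False
    proof (cases "d k \<le> d (Suc k)")
      case True
      have "u k = u (Suc k) * cis (s (Suc k) * d k)" by (simp add: u[of k] opp cis_mult mult.assoc)
      from arc[OF this] True d(1)[of k] ne[of k] show False by auto
    next
      case False
      have "u (Suc (Suc k)) = u k * cis (s k * (d k - d (Suc k)))"
        by (simp add: u[of k] u[of "Suc k"] opp cis_mult mult.assoc algebra_simps)
      moreover have "0 \<le> d k - d (Suc k)" "d k - d (Suc k) \<le> d k"
        using False d(1)[of "Suc k"] by auto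
      ultimately show False using arc[of "Suc (Suc k)" k] ne[of k] by metis
    qed
  qed
  have s0: "s k = s 0" for k by (induction k) (simp_all add: const)
  define S where "S n = (\<Sum>k<n. d k)" for n
  have uS: "u n = u 0 * cis (s 0 * S n)" for n
  proof (induction n)
    case (Suc n)
    then show ?case
      using u[of n] s0[of n] by (simp add: S_def cis_mult mult.assoc distrib_left)
  qed (simp add: S_def)
  have u0: "u 0 \<noteq> 0" using u1[of 0] by auto
  have "cis (s 0 * S m) = 1" using uS[of m] per u0 by simp
  then have "cos (S m) = 1" using s[of 0] by (auto simp: complex_eq_iff)
  then obtain N :: int where N: "S m = N * 2 * pi" by (auto simp: cos_one_2pi_int)
  have "S m > 0" unfolding S_def using m d(1) by (intro sum_pos) (auto simp: lessThan_empty_iff)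
  then have "N > 0" using N by (simp add: zero_less_mult_iff)
  then have "S m \<ge> 2 * pi" using N by simp
  define n where "n = (LEAST n. S n \<ge> 2 * pi)"
  have n: "S n \<ge> 2 * pi" unfolding n_def using \<open>S m \<ge> 2 * pi\<close> by (rule LeastI)
  have nm: "n \<le> m" unfolding n_def using \<open>S m \<ge> 2 * pi\<close> by (rule Least_le)
  have "n \<noteq> 0"
  proof
    assume "n = 0"
    then show False using n pi_gt_zero by (simp add: S_def)
  qed
  then obtain k where k: "n = Suc k" by (cases n) auto
  have Sk: "S k < 2 * pi" using not_less_Least[of k "\<lambda>n. S n \<ge> 2 * pi"] k by (auto simp: n_def)
  have SS: "S (Suc k) = S k + d k" by (simp add: S_def)
  have "u 0 = u k * cis (s k * (2 * pi - S k))"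
  proof -
    have "cis (s 0 * (2 * pi)) = 1" using s[of 0] by (auto simp: complex_eq_iff)
    then show ?thesis unfolding uS[of k] s0[of k] by (simp add: cis_mult mult.assoc algebra_simps)
  qed
  from arc[OF this] Sk n SS k have "0 mod m = k mod m \<or> 0 mod m = Suc k mod m" by auto
  moreover have "k \<noteq> 0"
  proof
    assume "k = 0"
    then have "S (Suc k) = d 0" by (simp add: S_def)
    then show False using n[unfolded k] d(2)[of 0] pi_gt_zero by linarith
  qed
  ultimately have "n = m" using nm k by (auto simp: le_less dest: dvd_imp_le)
  \<comment> \<open>The last arc is shorter than \<open>pi\<close>, so a total of \<open>4 * pi\<close> or more is impossible.\<close>
  then have "S m < 3 * pi" using Sk SS k d(2)[of k] by simp
  then have "real_of_int N * 2 < 3" unfolding N by (simp add: algebra_simps)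
  then have "N = 1" using \<open>N > 0\<close> by linarith
  then show ?thesis using N by (simp add: S_def d_def)
qed

section \<open>The central angle as a function of the interior angle\<close>

text \<open>
  With \<open>c = 1 / cosh x < 1\<close>, the derivative of \<open>beta x\<close> at \<open>t\<close> is
  \<open>- c * sin (t / 2) / sqrt (1 - c\<^sup>2 * (cos (t / 2))\<^sup>2)\<close>. It lies strictly between \<open>- 1\<close> and \<open>0\<close>, since
  \<open>c\<^sup>2 * ((sin (t / 2))\<^sup>2 + (cos (t / 2))\<^sup>2) < 1\<close>.
\<close>

lemma beta_diff_less:
  assumes x: "x > 0" and ab: "0 < a" "a < b" "b < pi"
  shows "\<bar>beta x a - beta x b\<bar> < b - a"
proof -
  define c where "c = 1 / cosh x"
  have c: "0 < c" "c < 1" using x cosh_real_strict_mono[of 0 x] by (auto simp: c_def)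
  have bt: "beta x = (\<lambda>t. 2 * arcsin (c * cos (t / 2)))" by (auto simp: beta_def c_def)
  have rng: "0 < c * cos (t/2)" "c * cos (t/2) < 1" if "a \<le> t" "t \<le> b" for t
  proof -
    have "0 < cos (t/2)" using that ab by (intro cos_gt_zero) auto
    then show "0 < c * cos (t/2)" using c by simp
    have "c * cos (t/2) \<le> c * 1" using c by (intro mult_left_mono cos_le_one) auto
    with c(2) show "c * cos (t/2) < 1" by linarith
  qed
  have der: "(beta x has_real_derivative - (c * sin (t/2)) / sqrt (1 - (c * cos (t/2))\<^sup>2)) (at t)" if "a \<le> t" "t \<le> b" for t
    unfolding bt using rng[OF that] by (auto intro!: derivative_eq_intros simp: field_simps)
  obtain t where t: "a < t" "t < b" "beta x b - beta x a = (b - a) * (- (c * sin (t/2)) / sqrt (1 - (c * cos (t/2))\<^sup>2))"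
    using MVT2[OF ab(2) der] by auto
  define q where "q = c * sin (t/2) / sqrt (1 - (c * cos (t/2))\<^sup>2)"
  have s: "0 < sin (t/2)" using t ab by (intro sin_gt_zero) auto
  have "c\<^sup>2 < 1" using c by (simp add: power_less_one_iff abs_square_less_1)
  have "(c * sin (t/2))\<^sup>2 = c\<^sup>2 - (c * cos (t/2))\<^sup>2"
    by (simp add: power_mult_distrib sin_squared_eq algebra_simps)
  then have "(c * sin (t/2))\<^sup>2 < 1 - (c * cos (t/2))\<^sup>2" using \<open>c\<^sup>2 < 1\<close> by simp
  then have "c * sin (t/2) < sqrt (1 - (c * cos (t/2))\<^sup>2)" by (rule real_less_rsqrt)
  moreover have "0 < c * sin (t/2)" using c s by simp
  ultimately have "0 < q" "q < 1" unfolding q_def by (metis divide_pos_pos order_less_trans, metis divide_less_eq_1_pos order_less_trans)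
  then have "0 < (b - a) * q" "(b - a) * q < b - a"
    using ab by simp_all
  moreover have "beta x a - beta x b = (b - a) * q"
    using t(3) by (simp add: q_def)
  ultimately show ?thesis by simp
qed

lemma beta_half:
  assumes "0 < a" "a < pi"
  shows "sin (beta x a / 2) = cos (a / 2) / cosh x" and "0 < beta x a" and "beta x a \<le> pi"
proof -
  have "0 < cos (a/2)" using assms by (intro cos_gt_zero) auto
  moreover have "cos (a/2) \<le> 1" by simp
  moreover have "1 \<le> cosh x" by (rule cosh_real_ge_1)
  ultimately have r: "0 < cos (a/2) / cosh x" "cos (a/2) / cosh x \<le> 1"
    by (simp_all add: divide_le_eq_1 del: cos_le_one)
  then show "sin (beta x a / 2) = cos (a / 2) / cosh x" by (simp add: beta_def)
  show "0 < beta x a" using r arcsin_less_arcsin[of 0 "cos (a/2) / cosh x"] by (simp add: beta_def)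
  show "beta x a \<le> pi" using r arcsin_bounded[of "cos (a/2) / cosh x"] by (simp add: beta_def)
qed

text \<open>
  Adding the relations \<open>sin (beta x a / 2) = cos (a / 2) / cosh x\<close> for both angles turns sums into
  products: the sine of the mean times \<open>cos ((beta x a - beta x b) / 4)\<close> equals the sine at the mean
  times \<open>cos ((a - b) / 4)\<close>. By \<open>beta_diff_less\<close> the first cosine is the larger one.
\<close>

lemma beta_midpoint:
  assumes x: "x > 0" and ab: "0 < a" "a < pi" "0 < b" "b < pi" "a \<noteq> b"
  shows "(beta x a + beta x b) / 2 < beta x ((a + b) / 2)"
proof -
  have d: "\<bar>beta x a - beta x b\<bar> < \<bar>a - b\<bar>"
    using beta_diff_less[OF x, of a b] beta_diff_less[OF x, of b a] ab by (auto simp: abs_minus_commute neq_iff)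
  define P where "P = (beta x a + beta x b) / 4"
  define Q where "Q = beta x ((a + b) / 2) / 2"
  note A = beta_half[OF ab(1,2), of x] and B = beta_half[OF ab(3,4), of x]
  have M: "sin Q = cos ((a + b) / 4) / cosh x" "0 < Q" "Q \<le> pi/2"
    using beta_half[of "(a+b)/2" x] ab by (auto simp: Q_def)
  have Pr: "0 < P" "P \<le> pi/2" using A B by (auto simp: P_def)
  have "sin P * cos ((beta x a - beta x b) / 4) = sin Q * cos ((a - b) / 4)"
  proof -
    have "sin (beta x a / 2) + sin (beta x b / 2) = 2 * sin P * cos ((beta x a - beta x b) / 4)"
      unfolding sin_plus_sin by (simp add: P_def add_divide_distrib diff_divide_distrib)
    moreover have "cos (a/2) + cos (b/2) = 2 * cos ((a+b)/4) * cos ((a - b)/4)"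
      unfolding cos_plus_cos by (simp add: add_divide_distrib diff_divide_distrib)
    ultimately show ?thesis unfolding A B M by (simp add: field_simps add_divide_distrib[symmetric])
  qed
  moreover have "cos ((a - b) / 4) < cos ((beta x a - beta x b) / 4)"
  proof -
    have "cos \<bar>(a - b)/4\<bar> < cos \<bar>(beta x a - beta x b)/4\<bar>"
      using d ab by (intro cos_monotone_0_pi) auto
    then show ?thesis by (simp only: cos_abs_real)
  qed
  moreover have "0 < cos ((a - b) / 4)" using ab by (intro cos_gt_zero_pi) auto
  moreover have "0 < sin P" using Pr by (intro sin_gt_zero) auto
  ultimately have "sin P < sin Q"
    by (smt (verit) mult_less_cancel_left_pos mult_right_mono)
  then have "P < Q" using Pr M sin_mono_le_eq[of Q P] by (smt (verit) pi_gt_zero)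
  then show ?thesis by (simp add: P_def Q_def)
qed

lemma beta_antimono:
  assumes "0 < x" "x \<le> y" "0 < a" "a < pi"
  shows "beta y a \<le> beta x a"
proof -
  have c: "0 < cos (a/2)" using assms by (intro cos_gt_zero) auto
  have "cosh x \<le> cosh y" using assms by (intro cosh_real_nonneg_le_iff[THEN iffD2]) auto
  then have "cos (a/2) / cosh y \<le> cos (a/2) / cosh x" using c by (intro divide_left_mono) auto
  moreover have "cos (a/2) / cosh x \<le> 1"
    using cosh_real_ge_1[of x] by (simp add: divide_simps order_trans[OF cos_le_one])
  moreover have "-1 \<le> cos (a/2) / cosh y" using c by (smt (verit) cosh_real_pos divide_pos_pos)
  ultimately show ?thesis unfolding beta_def by (intro mult_left_mono arcsin_le_arcsin) auto
qed

section \<open>Tangential polygons in the hyperbolic plane\<close>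

lemma next_ix_eq: "k < m \<Longrightarrow> next_ix m k = (if Suc k = m then 0 else Suc k)"
  by (simp add: next_ix_def)

lemma prev_ix_eq: "k < m \<Longrightarrow> prev_ix m k = (if k = 0 then m - 1 else k - 1)"
  by (auto simp: prev_ix_def mod_if)

lemma next_prev_ix:
  assumes "3 \<le> m" "k < m"
  shows "next_ix m k < m" "prev_ix m k < m" "next_ix m (prev_ix m k) = k" "next_ix m k \<noteq> k"
    "next_ix m (next_ix m k) \<noteq> k"
  using assms by (auto simp: next_ix_eq prev_ix_eq)

locale tangential_hpolygon =
  fixes m :: nat and v :: "nat \<Rightarrow> real^3" and X :: "real^3" and x :: real and T :: "nat \<Rightarrow> real^3"
  assumes convex: "convex_hpolygon m v" and inscribed: "inscribed_circle m v X x T"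
begin

text \<open>
  A functional with zero set the tangent at \<open>T k\<close>. It is negative at the centre of the circle, so
  negative values mark the inner side.
\<close>

definition polar :: "nat \<Rightarrow> real^3 \<Rightarrow> real" where
  "polar k y = mink (cosh x *\<^sub>R T k - X) y"

lemma three_le_m: "3 \<le> m" using convex by (simp add: convex_hpolygon_def)
lemmas ix = next_prev_ix[OF three_le_m]
lemma vertex_in_H2: "k < m \<Longrightarrow> v k \<in> H2" using convex by (simp add: convex_hpolygon_def)
lemma centre_in_H2: "X \<in> H2" and radius_pos: "x > 0" using inscribed by (simp_all add: inscribed_circle_def)
lemma cosh_radius_gt_1: "cosh x > 1" using radius_pos cosh_real_strict_mono[of 0 x] by simp

lemma tangent_point:
  assumes "k < m"
  shows "T k \<in> H2" "mink X (T k) = - cosh x"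
proof -
  have "T k \<in> hcircle X x" using inscribed assms by (auto simp: inscribed_circle_def)
  then show "T k \<in> H2" and "mink X (T k) = - cosh x"
    using H2_mink_le(1)[OF centre_in_H2, of "T k"] cosh_arcosh_real[of "- mink X (T k)"]
    by (auto simp: hcircle_def hdist_def)
qed

lemma T_on_side:
  assumes "k < m"
  obtains a b where "a \<ge> 0" "b \<ge> 0" "T k = a *\<^sub>R v k + b *\<^sub>R v (next_ix m k)"
  using inscribed assms by (auto simp: inscribed_circle_def hsegment_def)

lemma polar_eq: "polar k y = cosh x * mink (T k) y - mink X y"
  by (simp add: polar_def mink_bilinear)

lemma polar_endpoints:
  assumes "k < m"
  shows "polar k (v k) = 0" "polar k (v (next_ix m k)) = 0"
proof -
  let ?S = "span {v k, v (next_ix m k)}"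
  have "H2 \<inter> ?S \<inter> hcircle X x = {T k}" using inscribed assms by (auto simp: inscribed_circle_def hline_def)
  from tangent_line_polar[OF centre_in_H2 subspace_span this] tangent_point[OF assms]
  have "polar k y = 0" if "y \<in> H2" "y \<in> ?S" for y using that by (simp add: polar_eq)
  then show "polar k (v k) = 0" "polar k (v (next_ix m k)) = 0"
    using vertex_in_H2 assms ix by (auto simp: span_base)
qed

lemma polar_tangent_point:
  assumes "k < m" "j < m"
  shows "polar k (T j) \<le> 0" "polar k (T j) = 0 \<longleftrightarrow> T k = T j"
proof -
  have e: "polar k (T j) = cosh x * (mink (T k) (T j) + 1)"
    using tangent_point[OF assms(2)] by (simp add: polar_eq algebra_simps)
  show "polar k (T j) \<le> 0"
    unfolding e using cosh_radius_gt_1 H2_mink_le(1)[OF tangent_point(1)[OF assms(1)] tangent_point(1)[OF assms(2)]] by (intro mult_nonneg_nonpos) auto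
  show "polar k (T j) = 0 \<longleftrightarrow> T k = T j"
    unfolding e using cosh_radius_gt_1 H2_mink_le(2)[OF tangent_point(1)[OF assms(1)] tangent_point(1)[OF assms(2)]] by auto
qed

text \<open>
  The functional witnessing convexity is a multiple \<open>c\<close> of the polar functional. The sign of \<open>c\<close>
  is settled in \<open>polar_other_vertex\<close>.
\<close>

lemma side_functional:
  assumes "k < m"
  obtains c where "\<forall>l<m. l \<noteq> k \<longrightarrow> l \<noteq> next_ix m k \<longrightarrow> 0 < c * polar k (v l)"
proof -
  obtain n where n: "n \<bullet> v k = 0" "n \<bullet> v (next_ix m k) = 0"
    "\<And>l. l < m \<Longrightarrow> l \<noteq> k \<Longrightarrow> l \<noteq> next_ix m k \<Longrightarrow> 0 < n \<bullet> v l"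
    using convex assms by (auto simp: convex_hpolygon_def)
  have ne: "v k \<noteq> v (next_ix m k)"
    using convex assms ix[OF assms] by (auto simp: convex_hpolygon_def dest: inj_onD)
  have "mink (cosh x *\<^sub>R T k - X) X = 1 - (cosh x)\<^sup>2"
    using tangent_point(2)[OF assms] mink_self[OF centre_in_H2] by (simp add: mink_bilinear mink_commute[of "T k"] power2_eq_square)
  then have "cosh x *\<^sub>R T k - X \<noteq> 0" using cosh_radius_gt_1 by (auto simp: mink_def power2_eq_1_iff)
  from line_normal_unique[OF vertex_in_H2 vertex_in_H2 ne n(1,2) _ _ this] polar_endpoints[OF assms] assms ix
  obtain c where "\<And>y. n \<bullet> y = c * polar k y" by (auto simp: polar_def)
  with n(3) have "\<forall>l<m. l \<noteq> k \<longrightarrow> l \<noteq> next_ix m k \<longrightarrow> 0 < c * polar k (v l)" by simp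
  then show thesis by (rule that)
qed

text \<open>
  A common tangent point of consecutive sides would put three consecutive vertices on one line.
\<close>

lemma T_next_neq:
  assumes k: "k < m"
  shows "T (next_ix m k) \<noteq> T k"
proof
  let ?j = "next_ix m k"
  assume eq: "T ?j = T k"
  obtain c where c: "\<And>l. l < m \<Longrightarrow> l \<noteq> k \<Longrightarrow> l \<noteq> ?j \<Longrightarrow> 0 < c * polar k (v l)"
    using side_functional[OF k] by blast
  have "polar k (v (next_ix m ?j)) = 0" using polar_endpoints(2)[of ?j] ix[OF k] eq by (simp add: polar_def)
  with c[of "next_ix m ?j"] show False using ix[OF k] ix[of ?j] by auto
qed

text \<open>
  One value decides the sign for all vertices at once, and it is found on the next side: its tangent
  point lies on the circle, hence strictly inside the tangent at \<open>T k\<close>, and it is a nonnegative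
  combination of a zero of \<open>polar k\<close> and the vertex after it.
\<close>

lemma polar_other_vertex:
  assumes k: "k < m" and l: "l < m" "l \<noteq> k" "l \<noteq> next_ix m k"
  shows "polar k (v l) < 0"
proof -
  let ?j = "next_ix m k"
  obtain c where c: "\<And>l. l < m \<Longrightarrow> l \<noteq> k \<Longrightarrow> l \<noteq> ?j \<Longrightarrow> 0 < c * polar k (v l)"
    using side_functional[OF k] by blast
  have j: "?j < m" using ix[OF k] by simp
  obtain a b where ab: "a \<ge> 0" "b \<ge> 0" "T ?j = a *\<^sub>R v ?j + b *\<^sub>R v (next_ix m ?j)" using T_on_side[OF j] .
  have "polar k (T ?j) = b * polar k (v (next_ix m ?j))"
    using polar_endpoints(2)[OF k] by (simp add: ab(3) polar_def mink_bilinear)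
  moreover have "polar k (T ?j) < 0" using polar_tangent_point[OF k j] T_next_neq[OF k] by (auto simp: less_le)
  ultimately have "polar k (v (next_ix m ?j)) < 0" using ab(2) by (auto simp: mult_less_0_iff)
  moreover have "0 < c * polar k (v (next_ix m ?j))" using ix[OF k] ix[of ?j] by (intro c) auto
  ultimately have "c < 0" by (simp add: zero_less_mult_iff)
  with c[OF l] show ?thesis by (simp add: zero_less_mult_iff)
qed

text \<open>
  A vertex on the circle would be the tangent point of both sides through it.
\<close>

lemma T_neq_vertex:
  assumes "k < m"
  shows "T k \<noteq> v k" "T k \<noteq> v (next_ix m k)"
proof -
  have p: "prev_ix m k < m" "next_ix m (prev_ix m k) = k" and n: "next_ix m k < m" using ix[OF assms] by auto
  show "T k \<noteq> v k"
    using polar_endpoints(2)[OF p(1)] polar_tangent_point(2)[OF p(1) assms] T_next_neq[OF p(1)] p(2) by auto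
  show "T k \<noteq> v (next_ix m k)"
    using polar_endpoints(1)[OF n] polar_tangent_point(2)[OF n assms] T_next_neq[OF assms] by auto
qed

lemma central_angle_eq_beta:
  assumes k: "k < m"
  shows "central_angle m X T k = beta x (interior_angle m v k)"
proof -
  let ?p = "prev_ix m k" and ?n = "next_ix m k"
  have p: "?p < m" "next_ix m ?p = k" using ix[OF k] by auto
  \<comment> \<open>Otherwise \<open>t\<close> would be a multiple of \<open>v k\<close>, and a line through the origin meets \<open>H2\<close> at most once.\<close>
  have pos: "a > 0" if "a \<ge> 0" "b \<ge> 0" "t \<in> H2" "t = a *\<^sub>R q + b *\<^sub>R v k" "t \<noteq> v k" for a b t q
  proof (rule ccontr)
    assume "\<not> a > 0"
    then have t: "t = b *\<^sub>R v k" using that by simp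
    have "b\<^sup>2 = 1" using mink_self[OF that(3)] mink_self[OF vertex_in_H2[OF k]] by (simp add: t mink_bilinear power2_eq_square)
    then have "b = 1" using that(2) by (auto simp: power2_eq_1_iff)
    then show False using t that(5) by simp
  qed
  obtain a b where ab: "a \<ge> 0" "b \<ge> 0" "T ?p = a *\<^sub>R v ?p + b *\<^sub>R v k" using T_on_side[OF p(1)] p(2) by metis
  obtain a' b' where ab': "a' \<ge> 0" "b' \<ge> 0" "T k = b' *\<^sub>R v ?n + a' *\<^sub>R v k" using T_on_side[OF k] by (metis add.commute)
  have "a > 0" using pos[OF ab(1,2) tangent_point(1)[OF p(1)] ab(3)] T_neq_vertex(2)[OF p(1)] p(2) by simp
  moreover have "b' > 0" using pos[OF ab'(2,1) tangent_point(1)[OF k] ab'(3)] T_neq_vertex(1)[OF k] by simp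
  ultimately have "interior_angle m v k = hangle (v k) (T ?p) (T k)"
    unfolding interior_angle_def ab(3) ab'(3) using vertex_in_H2[OF k] by (simp add: hangle_scale)
  moreover have "central_angle m X T k = beta x (hangle (v k) (T ?p) (T k))"
    unfolding central_angle_def
    using centre_in_H2 vertex_in_H2[OF k] tangent_point[OF p(1)] tangent_point[OF k] radius_pos T_next_neq[OF p(1)] T_neq_vertex(2)[OF p(1)] p(2)
      polar_endpoints(2)[OF p(1)] polar_endpoints(1)[OF k]
    by (intro tangential_kite) (auto simp: polar_eq)
  ultimately show ?thesis by simp
qed

text \<open>
  Coordinates in an orthonormal frame at \<open>X\<close>, divided by the \<open>X\<close>-component, give the Klein model
  with centre \<open>X\<close>. There the circle is Euclidean of radius \<open>tanh x\<close>, the angles at \<open>X\<close> are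
  Euclidean, and tangents remain tangents. Scaling the circle to the unit circle makes \<open>u k\<close> of the
  tangent points and \<open>w k\<close> of the vertices, so that \<open>sum_central_arcs\<close> applies. The tangent points
  are indexed with a shift by one, which makes \<open>w k\<close> the intersection of the tangents at \<open>u k\<close> and
  \<open>u (Suc k)\<close>.
\<close>

lemma sum_central_angles: "(\<Sum>k<m. central_angle m X T k) = 2 * pi"
proof -
  define C where "C = cosh x"
  define r where "r = sqrt (C\<^sup>2 - 1)"
  have C1: "C > 1" using cosh_radius_gt_1 by (simp add: C_def)
  then have r: "r > 0" "r\<^sup>2 = C\<^sup>2 - 1" by (simp_all add: r_def)
  obtain e f where ef: "\<And>p q. mink p q = mink e p * mink e q + mink f p * mink f q - mink X p * mink X q"
    using orthonormal_frame[OF centre_in_H2] by blast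
  define z where "z p = Complex (mink e p) (mink f p)" for p
  have z: "Re (z p * cnj (z q)) = mink p q + mink X p * mink X q" for p q
    using ef[of p q] by (simp add: z_def)
  define h where "h k = - mink X (v (k mod m))" for k
  define t where "t k = T (prev_ix m (k mod m))" for k
  define u where "u k = of_real (1 / r) * z (t k)" for k
  define w where "w k = of_real (C / (h k * r)) * z (v (k mod m))" for k
  have km: "k mod m < m" for k using three_le_m by simp
  have h: "h k > 0" for k using H2_mink_le(1)[OF centre_in_H2 vertex_in_H2[OF km], of k] by (simp add: h_def)
  have t: "t k \<in> H2" "mink X (t k) = - C" for k
    using tangent_point[of "prev_ix m (k mod m)"] ix(2)[OF km] by (simp_all add: t_def C_def)
  have sc: "Re (of_real c * p * cnj (of_real d * q)) = c * d * Re (p * cnj q)" for c d p q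
    by (simp add: algebra_simps)
  have uu: "Re (u k * cnj (u j)) = (mink (t k) (t j) + C\<^sup>2) / (C\<^sup>2 - 1)" for k j
    unfolding u_def sc z t r(2)[symmetric] using r(1) by (simp add: power2_eq_square field_simps)
  have wu: "Re (w k * cnj (u j)) = 1 + polar (prev_ix m (j mod m)) (v (k mod m)) / (h k * (C\<^sup>2 - 1))" for k j
  proof -
    have "Re (w k * cnj (u j)) = C * (mink (v (k mod m)) (t j) + h k * C) / (h k * r\<^sup>2)"
      unfolding w_def u_def sc z t using r(1) by (simp add: h_def power2_eq_square)
    also have "C * (mink (v (k mod m)) (t j) + h k * C) = polar (prev_ix m (j mod m)) (v (k mod m)) + h k * r\<^sup>2"
      unfolding r(2) by (simp add: polar_eq t_def h_def C_def mink_commute[of "T _"] algebra_simps power2_eq_square)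
    finally show ?thesis using h[of k] r(1) unfolding r(2)[symmetric] by (simp add: add_divide_distrib)
  qed
  have hr: "h k * (C\<^sup>2 - 1) > 0" for k using h r by (metis mult_pos_pos zero_less_power)
  have sk: "prev_ix m (Suc k mod m) = k mod m" for k
    using km[of k] by (auto simp: mod_Suc prev_ix_eq)
  have np: "next_ix m (prev_ix m (k mod m)) = k mod m" for k using ix(3)[OF km] .
  have "(\<Sum>k<m. arccos (Re (u k * cnj (u (Suc k))))) = 2 * pi"
  proof (rule sum_central_arcs[OF three_le_m])
    show "norm (u k) = 1" for k
    proof -
      have "(norm (u k))\<^sup>2 = Re (u k * cnj (u k))" by (simp add: complex_norm_square[symmetric])
      also have "\<dots> = 1" unfolding uu using mink_self[OF t(1)] r by auto
      finally show ?thesis using norm_ge_zero[of "u k"] by (auto simp: power2_eq_1_iff)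
    qed
    show "u m = u 0" by (simp add: u_def t_def)
    show "Re (w k * cnj (u k)) = 1" for k
      unfolding wu using polar_endpoints(2)[OF ix(2)[OF km[of k]]] by (simp add: np)
    show "Re (w k * cnj (u (Suc k))) = 1" for k
      unfolding wu sk using polar_endpoints(1)[OF km[of k]] by simp
    show "Re (w k * cnj (u j)) < 1" if "j mod m \<noteq> k mod m" "j mod m \<noteq> Suc k mod m" for k j
    proof -
      let ?i = "prev_ix m (j mod m)"
      have i: "?i < m" "next_ix m ?i = j mod m" using ix[OF km] by auto
      have "k mod m \<noteq> ?i"
      proof
        assume "k mod m = ?i"
        then have "next_ix m (k mod m) = j mod m" using i by simp
        then show False using that(2) by (simp add: next_ix_def mod_Suc_eq)
      qed
      then have "polar ?i (v (k mod m)) < 0" using that i km by (intro polar_other_vertex) auto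
      then show ?thesis unfolding wu using hr[of k] by (simp add: divide_neg_pos)
    qed
  qed
  moreover have "arccos (Re (u k * cnj (u (Suc k)))) = central_angle m X T k" if "k < m" for k
    unfolding uu central_angle_def
    using hangle_isosceles[OF centre_in_H2 t(1) t(1) t(2) t(2) C1, of k "Suc k"] that by (simp add: t_def sk)
  ultimately show ?thesis by simp
qed

lemma sum_beta: "(\<Sum>k<m. beta x (interior_angle m v k)) = 2 * pi"
  using sum_central_angles by (simp add: central_angle_eq_beta)

end

section \<open>Averaging two angles increases the inradius\<close>

theorem theorem4p1:
  fixes m :: nat and \<alpha> :: "nat \<Rightarrow> real" and \<sigma> :: "nat \<Rightarrow> nat"
    and v :: "nat \<Rightarrow> real ^ 3" and X :: "real ^ 3" and x :: real
    and T :: "nat \<Rightarrow> real ^ 3" and i j :: nat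
  assumes "m \<ge> 3"
    and "\<forall>k\<in>{1..m}. 0 < \<alpha> k \<and> \<alpha> k < pi"
    and "(\<Sum>k=1..m. \<alpha> k) < (real m - 2) * pi"
    and "\<alpha> 1 \<noteq> \<alpha> 2"
    and "bij_betw \<sigma> {..<m} {1..m}"
    and "convex_hpolygon m v"
    and "\<forall>k<m. interior_angle m v k = \<alpha> (\<sigma> k)"
    and "inscribed_circle m v X x T"
    and "i < m" "\<sigma> i = 1"
    and "j < m" "\<sigma> j = 2"
  shows "central_angle m X T i = beta x (\<alpha> 1) \<and>
    central_angle m X T j = beta x (\<alpha> 2) \<and>
    beta x ((\<alpha> 1 + \<alpha> 2) / 2) > (beta x (\<alpha> 1) + beta x (\<alpha> 2)) / 2 \<and>
    (\<forall>v' X' x' T'.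
       convex_hpolygon m v' \<longrightarrow>
       (\<forall>k<m. interior_angle m v' k =
          (\<alpha>(1 := (\<alpha> 1 + \<alpha> 2) / 2, 2 := (\<alpha> 1 + \<alpha> 2) / 2)) (\<sigma> k)) \<longrightarrow>
       inscribed_circle m v' X' x' T' \<longrightarrow>
       x' > x)"
proof -
  interpret P: tangential_hpolygon m v X x T
    using assms(6,8) by unfold_locales
  define \<mu> where "\<mu> = (\<alpha> 1 + \<alpha> 2) / 2"
  define \<alpha>' where "\<alpha>' = \<alpha>(1 := \<mu>, 2 := \<mu>)"
  have \<alpha>: "0 < \<alpha> k" "\<alpha> k < pi" if "k \<in> {1..m}" for k using assms(2) that by auto
  have a12: "0 < \<alpha> 1" "\<alpha> 1 < pi" "0 < \<alpha> 2" "\<alpha> 2 < pi" using \<alpha>[of 1] \<alpha>[of 2] assms(1) by auto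
  have mid: "(beta x (\<alpha> 1) + beta x (\<alpha> 2)) / 2 < beta x \<mu>"
    unfolding \<mu>_def by (rule beta_midpoint[OF P.radius_pos a12 assms(4)])
  have \<alpha>': "0 < \<alpha>' k" "\<alpha>' k < pi" if "k \<in> {1..m}" for k
    using \<alpha>[OF that] a12 by (auto simp: \<alpha>'_def \<mu>_def)
  have reindex: "(\<Sum>k<m. g (\<sigma> k)) = (\<Sum>k=1..m. g k)" for g :: "nat \<Rightarrow> real"
    using sum.reindex_bij_betw[OF assms(5)] .
  have sum_x: "(\<Sum>k=1..m. beta x (\<alpha> k)) = 2 * pi"
    using P.sum_beta assms(7) by (simp only: reindex[of "\<lambda>k. beta x (\<alpha> k)", symmetric]) simp
  have split: "(\<Sum>k=1..m. g k) = g 1 + g 2 + (\<Sum>k=3..m. g k)" for g :: "nat \<Rightarrow> real"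
  proof -
    have "{1..m} = insert 1 (insert 2 {3..m})" using assms(1) by auto
    then show ?thesis by simp
  qed
  have "(\<Sum>k=1..m. beta x (\<alpha>' k)) = 2 * beta x \<mu> + (\<Sum>k=3..m. beta x (\<alpha> k))"
    unfolding split by (simp add: \<alpha>'_def)
  then have gt: "2 * pi < (\<Sum>k=1..m. beta x (\<alpha>' k))"
    using mid sum_x unfolding split[of "\<lambda>k. beta x (\<alpha> k)"] by simp
  have "x' > x" if that': "convex_hpolygon m v'" "\<forall>k<m. interior_angle m v' k = \<alpha>' (\<sigma> k)"
    "inscribed_circle m v' X' x' T'" for v' X' x' T'
  proof (rule ccontr)
    interpret P': tangential_hpolygon m v' X' x' T' using that' by unfold_locales
    assume "\<not> x' > x"
    then have "(\<Sum>k=1..m. beta x (\<alpha>' k)) \<le> (\<Sum>k=1..m. beta x' (\<alpha>' k))"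
      using \<alpha>' P'.radius_pos by (intro sum_mono beta_antimono) auto
    also have "\<dots> = 2 * pi"
      using P'.sum_beta that'(2) by (simp only: reindex[of "\<lambda>k. beta x' (\<alpha>' k)", symmetric]) simp
    finally show False using gt by simp
  qed
  then show ?thesis
    using mid P.central_angle_eq_beta assms(7,9-12) unfolding \<alpha>'_def \<mu>_def by simp
qed

end
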